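(* Let $Q$ be a finite set, $\rho:Q\to\mathbb{N}$, $m=\max\rho$, and let $0\le k\le m$. The applicative structure $\mathcal{D}^k=(\mathcal{D}^k_A)_A$ described in the context, with $Y^A$ interpreted as $\mathrm{fix}^k_A$ and every other constant interpreted by an element of $\mathcal{D}^k$ of the corresponding type, is a model of the $\lambda Y$-calculus: (i) for every term $M$ of type $A$ and every valuation $\nu$ mapping each free variable of type $B$ of $M$ to an element of $\mathcal{D}^k_B$, the interpretation $[\![M]\!]^k_\nu$ (variables via $\nu$, application as function application, $\lambda x.M$ as $p\mapsto[\![M]\!]^k_{\nu[p/x]}$) is an element of $\mathcal{D}^k_A$; and (ii) if $M=_{\beta\delta}N$ then $[\![M]\!]^k_\nu=[\![N]\!]^k_\nu$ for every valuation $\nu$.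
   Context: Simple types over base type $o$; $\lambda Y$-terms are simply typed $\lambda$-terms with constants including $Y^A:(A\to A)\to A$; $=_{\beta\delta}$ is generated by $(\lambda x.M)N=M[x:=N]$ and $YM=M(YM)$. Let $Q_k=\{q:\rho(q)=k\}$, $Q_{\le k}=\{q:\rho(q)\le k\}$. Define $\mathcal{D}^0_o=\mathcal{P}(Q_0)$, $\mathcal{D}^0_{A\to B}$ = all monotone maps $\mathcal{D}^0_A\to\mathcal{D}^0_B$; for $k>0$: $\mathcal{D}^k_o=\mathcal{P}(Q_{\le k})$, $\mathcal{L}^k_o=\{(R,P)\in\mathcal{D}^{k-1}_o\times\mathcal{D}^k_o: R=P\cap Q_{\le k-1}\}$, $\mathcal{L}^k_{A\to B}=\{(f_1,f_2): f_1\in\mathcal{D}^{k-1}_{A\to B}$, $f_2$ a monotone map $\mathcal{D}^k_A\to\mathcal{D}^k_B$, with $(f_1(g_1),f_2(g_2))\in\mathcal{L}^k_B$ for all $(g_1,g_2)\in\mathcal{L}^k_A\}$, and $\mathcal{D}^k_{A\to B}=\{f_2:\exists f_1,(f_1,f_2)\in\mathcal{L}^k_{A\to B}\}$. Orders: inclusion at $o$, pointwise at arrow types. Each $\mathcal{D}^k_A$ is a finite lattice with greatest element $\top^k_A$; for $k>0$ each $e\in\mathcal{D}^k_A$ has a unique $e^\downarrow\in\mathcal{D}^{k-1}_A$ with $(e^\downarrow,e)\in\mathcal{L}^k_A$, and for $d\in\mathcal{D}^{k-1}_A$ the set $\{e:(d,e)\in\mathcal{L}^k_A\}$ has a greatest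 element $d^{\uparrow\top}$ and least element $d^{\uparrow\bot}$. Fixpoints: $\mathrm{fix}^0_A(f)=\bigwedge_{n\ge0}f^n(\top^0_A)$; for $2k>0$, $f\in\mathcal{D}^{2k}_{A\to A}$: $\mathrm{fix}^{2k}_A(f)=\bigwedge_{n}f^n((\mathrm{fix}^{2k-1}_A(f^\downarrow))^{\uparrow\top})$; for $f\in\mathcal{D}^{2k+1}_{A\to A}$: $\mathrm{fix}^{2k+1}_A(f)=\bigvee_n f^n((\mathrm{fix}^{2k}_A(f^\downarrow))^{\uparrow\bot})$. *)

theory Defs
  imports Main "HOL-Library.FSet" "HOL-Library.FuncSet"
begin

datatype ty = Ground ("\<o>") | Arr ty ty (infixr "\<Rrightarrow>" 65)

text \<open>
  A variable is a name together with its type, so every type has infinitely many variables.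
  The parameter \<open>'c\<close> is the set of constants other than the fixpoint combinators.
\<close>

type_synonym var = "nat \<times> ty"

datatype 'c trm =
    Var var
  | Con 'c
  | Ycomb ty
  | App "'c trm" "'c trm"
  | Lam var "'c trm"

inductive has_type :: "('c \<Rightarrow> ty) \<Rightarrow> 'c trm \<Rightarrow> ty \<Rightarrow> bool" for ctype :: "'c \<Rightarrow> ty" where
  "has_type ctype (Var (x, A)) A"
| "has_type ctype (Con c) (ctype c)"
| "has_type ctype (Ycomb A) ((A \<Rrightarrow> A) \<Rrightarrow> A)"
| "has_type ctype M (A \<Rrightarrow> B) \<Longrightarrow> has_type ctype N A \<Longrightarrow> has_type ctype (App M N) B"
| "has_type ctype M B \<Longrightarrow> has_type ctype (Lam (x, A) M) (A \<Rrightarrow> B)"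

primrec FV :: "'c trm \<Rightarrow> var set" where
  "FV (Var v) = {v}"
| "FV (Con c) = {}"
| "FV (Ycomb A) = {}"
| "FV (App M N) = FV M \<union> FV N"
| "FV (Lam v M) = FV M - {v}"

text \<open>
  Capture-avoiding substitution: passing simultaneous substitutions makes the recursion
  structural. A bound variable is renamed, within its type, exactly when it would capture.
\<close>

definition pick_fresh :: "var \<Rightarrow> var set \<Rightarrow> var" where
  "pick_fresh v F = (if v \<notin> F then v else ((LEAST n. (n, snd v) \<notin> F), snd v))"

primrec psubst :: "(var \<Rightarrow> 'c trm) \<Rightarrow> 'c trm \<Rightarrow> 'c trm" where
  "psubst \<sigma> (Var v) = \<sigma> v"
| "psubst \<sigma> (Con c) = Con c"
| "psubst \<sigma> (Ycomb A) = Ycomb A"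
| "psubst \<sigma> (App M N) = App (psubst \<sigma> M) (psubst \<sigma> N)"
| "psubst \<sigma> (Lam v M) =
     (let w = pick_fresh v (\<Union>u \<in> FV M - {v}. FV (\<sigma> u))
      in Lam w (psubst (\<sigma>(v := Var w)) M))"

definition subst :: "'c trm \<Rightarrow> var \<Rightarrow> 'c trm \<Rightarrow> 'c trm" ("_[_::=_]" [100, 0, 0] 100) where
  "M[v::=N] = psubst (Var(v := N)) M"

text \<open>
  \<open>\<beta>\<delta>\<close>-equality of terms of type \<open>A\<close>. Terms are identified up to renaming of bound
  variables, hence the rule \<open>alpha\<close>.
\<close>

inductive bd_eq :: "('c \<Rightarrow> ty) \<Rightarrow> ty \<Rightarrow> 'c trm \<Rightarrow> 'c trm \<Rightarrow> bool" for ctype :: "'c \<Rightarrow> ty" where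
  refl: "has_type ctype M A \<Longrightarrow> bd_eq ctype A M M"
| sym: "bd_eq ctype A M N \<Longrightarrow> bd_eq ctype A N M"
| trans: "bd_eq ctype A M N \<Longrightarrow> bd_eq ctype A N P \<Longrightarrow> bd_eq ctype A M P"
| app: "bd_eq ctype (A \<Rrightarrow> B) M M' \<Longrightarrow> bd_eq ctype A N N' \<Longrightarrow> bd_eq ctype B (App M N) (App M' N')"
| lam: "bd_eq ctype B M M' \<Longrightarrow> bd_eq ctype (A \<Rrightarrow> B) (Lam (x, A) M) (Lam (x, A) M')"
| alpha: "has_type ctype M B \<Longrightarrow> (y, A) \<notin> FV M \<Longrightarrow>
    bd_eq ctype (A \<Rrightarrow> B) (Lam (x, A) M) (Lam (y, A) (M[(x, A) ::= Var (y, A)]))"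
| beta: "has_type ctype M B \<Longrightarrow> has_type ctype N A \<Longrightarrow>
    bd_eq ctype B (App (Lam (x, A) M) N) (M[(x, A) ::= N])"
| delta: "has_type ctype M (A \<Rrightarrow> A) \<Longrightarrow>
    bd_eq ctype A (App (Ycomb A) M) (App M (App (Ycomb A) M))"

text \<open>
  A common universe for the elements of all the domains: subsets of \<open>Q\<close>, and functions
  represented by their graphs. Graphs are finite sets, which suffices because every domain is
  finite when \<open>Q\<close> is; \<open>mk_fun X f\<close> is the function \<open>f\<close> restricted to a finite domain \<open>X\<close>.
\<close>

datatype 'q val = Base "'q set" | Graph "('q val \<times> 'q val) fset"

definition mk_fun :: "'q val set \<Rightarrow> ('q val \<Rightarrow> 'q val) \<Rightarrow> 'q val" where
  "mk_fun X f = Graph (Abs_fset ((\<lambda>x. (x, f x)) ` X))"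

fun app :: "'q val \<Rightarrow> 'q val \<Rightarrow> 'q val" where
  "app (Graph G) x = (THE y. (x, y) |\<in>| G)"
| "app (Base P) x = undefined"

definition base_le :: "'q val \<Rightarrow> 'q val \<Rightarrow> bool" where
  "base_le x y \<longleftrightarrow> (\<exists>P R. x = Base P \<and> y = Base R \<and> P \<subseteq> R)"

definition mono_maps ::
  "'q val set \<Rightarrow> ('q val \<Rightarrow> 'q val \<Rightarrow> bool) \<Rightarrow> 'q val set \<Rightarrow> ('q val \<Rightarrow> 'q val \<Rightarrow> bool) \<Rightarrow> 'q val set"
where
  "mono_maps X leX Z leZ =
     {mk_fun X f | f. f \<in> X \<rightarrow> Z \<and> (\<forall>x\<in>X. \<forall>y\<in>X. leX x y \<longrightarrow> leZ (f x) (f y))}"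

definition greatest_in :: "('a \<Rightarrow> 'a \<Rightarrow> bool) \<Rightarrow> 'a set \<Rightarrow> 'a" where
  "greatest_in le X = (THE x. x \<in> X \<and> (\<forall>y\<in>X. le y x))"

definition least_in :: "('a \<Rightarrow> 'a \<Rightarrow> bool) \<Rightarrow> 'a set \<Rightarrow> 'a" where
  "least_in le X = (THE x. x \<in> X \<and> (\<forall>y\<in>X. le x y))"

definition Q_eq :: "'q set \<Rightarrow> ('q \<Rightarrow> nat) \<Rightarrow> nat \<Rightarrow> 'q set" where
  "Q_eq Q \<rho> k = {q \<in> Q. \<rho> q = k}"

definition Q_le :: "'q set \<Rightarrow> ('q \<Rightarrow> nat) \<Rightarrow> nat \<Rightarrow> 'q set" where
  "Q_le Q \<rho> k = {q \<in> Q. \<rho> q \<le> k}"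

text \<open>
  \<open>Dom Q \<rho> k A\<close> is \<open>\<D>\<^sup>k\<^sub>A\<close>, \<open>dle Q \<rho> k A\<close> its order, and \<open>Lrel Q \<rho> k A\<close> is \<open>\<L>\<^sup>k\<^sub>A\<close>, which
  relates levels \<open>k - 1\<close> and \<open>k\<close> and has no meaning at \<open>k = 0\<close> (there it is set to \<open>{}\<close>
  and never used).
\<close>

function (sequential)
      Dom :: "'q set \<Rightarrow> ('q \<Rightarrow> nat) \<Rightarrow> nat \<Rightarrow> ty \<Rightarrow> 'q val set"
  and dle :: "'q set \<Rightarrow> ('q \<Rightarrow> nat) \<Rightarrow> nat \<Rightarrow> ty \<Rightarrow> 'q val \<Rightarrow> 'q val \<Rightarrow> bool"
  and Lrel :: "'q set \<Rightarrow> ('q \<Rightarrow> nat) \<Rightarrow> nat \<Rightarrow> ty \<Rightarrow> ('q val \<times> 'q val) set"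
where
  "Dom Q \<rho> 0 \<o> = Base ` Pow (Q_eq Q \<rho> 0)"
| "Dom Q \<rho> 0 (A \<Rrightarrow> B) = mono_maps (Dom Q \<rho> 0 A) (dle Q \<rho> 0 A) (Dom Q \<rho> 0 B) (dle Q \<rho> 0 B)"
| "Dom Q \<rho> (Suc k) \<o> = Base ` Pow (Q_le Q \<rho> (Suc k))"
| "Dom Q \<rho> (Suc k) (A \<Rrightarrow> B) = {f2. \<exists>f1. (f1, f2) \<in> Lrel Q \<rho> (Suc k) (A \<Rrightarrow> B)}"

| "dle Q \<rho> k \<o> = base_le"
| "dle Q \<rho> k (A \<Rrightarrow> B) = (\<lambda>f g. \<forall>x \<in> Dom Q \<rho> k A. dle Q \<rho> k B (app f x) (app g x))"

| "Lrel Q \<rho> 0 A = {}"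
| "Lrel Q \<rho> (Suc k) \<o> =
     {(Base R, Base P) | R P. Base R \<in> Dom Q \<rho> k \<o> \<and> Base P \<in> Dom Q \<rho> (Suc k) \<o> \<and>
        R = P \<inter> Q_le Q \<rho> k}"
| "Lrel Q \<rho> (Suc k) (A \<Rrightarrow> B) =
     {(f1, f2). f1 \<in> Dom Q \<rho> k (A \<Rrightarrow> B) \<and>
        f2 \<in> mono_maps (Dom Q \<rho> (Suc k) A) (dle Q \<rho> (Suc k) A)
                       (Dom Q \<rho> (Suc k) B) (dle Q \<rho> (Suc k) B) \<and>
        (\<forall>(g1, g2) \<in> Lrel Q \<rho> (Suc k) A. (app f1 g1, app f2 g2) \<in> Lrel Q \<rho> (Suc k) B)}"
  by pat_completeness auto
termination
  by (relation "measures
    [\<lambda>s. case s of Inl (Q, \<rho>, k, A) \<Rightarrow> k | Inr (Inl (Q, \<rho>, k, A)) \<Rightarrow> k | Inr (Inr (Q, \<rho>, k, A)) \<Rightarrow> k,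
     \<lambda>s. case s of Inl (Q, \<rho>, k, A) \<Rightarrow> size A | Inr (Inl (Q, \<rho>, k, A)) \<Rightarrow> size A
            | Inr (Inr (Q, \<rho>, k, A)) \<Rightarrow> size A,
     \<lambda>s. case s of Inl (Q, \<rho>, k, A) \<Rightarrow> (case A of \<o> \<Rightarrow> 0 | _ \<Rightarrow> 1) | Inr (Inl _) \<Rightarrow> 0
            | Inr (Inr (Q, \<rho>, k, A)) \<Rightarrow> (case A of \<o> \<Rightarrow> 1 | _ \<Rightarrow> 0)]") auto

definition top_el :: "'q set \<Rightarrow> ('q \<Rightarrow> nat) \<Rightarrow> nat \<Rightarrow> ty \<Rightarrow> 'q val" where
  "top_el Q \<rho> k A = greatest_in (dle Q \<rho> k A) (Dom Q \<rho> k A)"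

definition meet :: "'q set \<Rightarrow> ('q \<Rightarrow> nat) \<Rightarrow> nat \<Rightarrow> ty \<Rightarrow> 'q val set \<Rightarrow> 'q val" where
  "meet Q \<rho> k A S = greatest_in (dle Q \<rho> k A) {d \<in> Dom Q \<rho> k A. \<forall>s\<in>S. dle Q \<rho> k A d s}"

definition join :: "'q set \<Rightarrow> ('q \<Rightarrow> nat) \<Rightarrow> nat \<Rightarrow> ty \<Rightarrow> 'q val set \<Rightarrow> 'q val" where
  "join Q \<rho> k A S = least_in (dle Q \<rho> k A) {d \<in> Dom Q \<rho> k A. \<forall>s\<in>S. dle Q \<rho> k A s d}"

text \<open>
  In the next three definitions \<open>k\<close> is the level of the result: \<open>down\<close> goes from level
  \<open>k + 1\<close> to \<open>k\<close>, the two lifts from level \<open>k - 1\<close> to \<open>k\<close>.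
\<close>

definition down :: "'q set \<Rightarrow> ('q \<Rightarrow> nat) \<Rightarrow> nat \<Rightarrow> ty \<Rightarrow> 'q val \<Rightarrow> 'q val" where
  "down Q \<rho> k A e = (THE d. d \<in> Dom Q \<rho> k A \<and> (d, e) \<in> Lrel Q \<rho> (Suc k) A)"

definition up_top :: "'q set \<Rightarrow> ('q \<Rightarrow> nat) \<Rightarrow> nat \<Rightarrow> ty \<Rightarrow> 'q val \<Rightarrow> 'q val" where
  "up_top Q \<rho> k A d = greatest_in (dle Q \<rho> k A) {e. (d, e) \<in> Lrel Q \<rho> k A}"

definition up_bot :: "'q set \<Rightarrow> ('q \<Rightarrow> nat) \<Rightarrow> nat \<Rightarrow> ty \<Rightarrow> 'q val \<Rightarrow> 'q val" where
  "up_bot Q \<rho> k A d = least_in (dle Q \<rho> k A) {e. (d, e) \<in> Lrel Q \<rho> k A}"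

primrec fixpt :: "'q set \<Rightarrow> ('q \<Rightarrow> nat) \<Rightarrow> nat \<Rightarrow> ty \<Rightarrow> 'q val \<Rightarrow> 'q val" where
  "fixpt Q \<rho> 0 A f = meet Q \<rho> 0 A {(app f ^^ n) (top_el Q \<rho> 0 A) | n. True}"
| "fixpt Q \<rho> (Suc k) A f =
     (let d = fixpt Q \<rho> k A (down Q \<rho> k (A \<Rrightarrow> A) f) in
      if even (Suc k)
      then meet Q \<rho> (Suc k) A {(app f ^^ n) (up_top Q \<rho> (Suc k) A d) | n. True}
      else join Q \<rho> (Suc k) A {(app f ^^ n) (up_bot Q \<rho> (Suc k) A d) | n. True})"

primrec interp ::
  "'q set \<Rightarrow> ('q \<Rightarrow> nat) \<Rightarrow> nat \<Rightarrow> ('c \<Rightarrow> 'q val) \<Rightarrow> (var \<Rightarrow> 'q val) \<Rightarrow> 'c trm \<Rightarrow> 'q val"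
where
  "interp Q \<rho> k I \<nu> (Var v) = \<nu> v"
| "interp Q \<rho> k I \<nu> (Con c) = I c"
| "interp Q \<rho> k I \<nu> (Ycomb A) = mk_fun (Dom Q \<rho> k (A \<Rrightarrow> A)) (fixpt Q \<rho> k A)"
| "interp Q \<rho> k I \<nu> (App M N) = app (interp Q \<rho> k I \<nu> M) (interp Q \<rho> k I \<nu> N)"
| "interp Q \<rho> k I \<nu> (Lam v M) =
     mk_fun (Dom Q \<rho> k (snd v)) (\<lambda>p. interp Q \<rho> k I (\<nu>(v := p)) M)"

definition valuation_on ::
  "'q set \<Rightarrow> ('q \<Rightarrow> nat) \<Rightarrow> nat \<Rightarrow> var set \<Rightarrow> (var \<Rightarrow> 'q val) \<Rightarrow> bool"
where
  "valuation_on Q \<rho> k V \<nu> \<longleftrightarrow> (\<forall>(x, B) \<in> V. \<nu> (x, B) \<in> Dom Q \<rho> k B)"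

end

theory Submission imports Defs begin

text \<open>
  The relation \<open>\<L>\<^sup>k\<close> is the graph of a monotone surjection \<open>\<down>\<close> whose fibres have greatest and
  least elements. If \<open>d\<close> is a fixpoint of \<open>f\<^sup>\<down>\<close>, then \<open>f\<close> preserves the fibre over \<open>d\<close>, so iterating
  \<open>f\<close> from an extremal element of that fibre gives a monotone sequence in a finite poset; it
  stabilises at a fixpoint of \<open>f\<close> lying over \<open>d\<close>. Hence the meets and joins defining \<open>fix\<^sup>k\<close> are
  attained by an iterate, and \<open>(fix\<^sup>k, fix\<^sup>k\<^sup>+\<^sup>1)\<close> belongs to \<open>\<L>\<^sup>k\<^sup>+\<^sup>1\<close>. The
  interpretations at consecutive levels are then related by \<open>\<L>\<close> as in the fundamental lemma of
  logical relations, which is what puts the meaning of an abstraction into \<open>\<D>\<^sup>k\<close>.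
\<close>

subsection \<open>Function graphs, extremal elements and fresh variables\<close>

text \<open>\<open>Abs_fset\<close> is meaningful only on finite sets, so reading a value back from
  a graph needs a finite domain.\<close>

lemma app_mk_fun: "finite X \<Longrightarrow> x \<in> X \<Longrightarrow> app (mk_fun X f) x = f x"
  unfolding mk_fun_def by (auto simp: Abs_fset_inverse)

lemma mk_fun_cong: "(\<And>x. x \<in> X \<Longrightarrow> f x = g x) \<Longrightarrow> mk_fun X f = mk_fun X g"
  unfolding mk_fun_def by (metis (no_types, lifting) image_cong)

text \<open>The conjunct \<open>f = mk_fun X (app f)\<close> is extensionality: a member is
  recovered from its values on \<open>X\<close>, which later gives antisymmetry at arrow
  types.\<close>

lemma mono_maps_iff:
  assumes "finite X"
  shows "f \<in> mono_maps X leX Z leZ \<longleftrightarrow>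
    f = mk_fun X (app f) \<and> (\<forall>x\<in>X. app f x \<in> Z) \<and>
    (\<forall>x\<in>X. \<forall>y\<in>X. leX x y \<longrightarrow> leZ (app f x) (app f y))"
proof
  assume "f \<in> mono_maps X leX Z leZ"
  then obtain h where h: "f = mk_fun X h" "h \<in> X \<rightarrow> Z" "\<forall>x\<in>X. \<forall>y\<in>X. leX x y \<longrightarrow> leZ (h x) (h y)"
    unfolding mono_maps_def by auto
  have "app f x = h x" if "x \<in> X" for x
    using that h(1) app_mk_fun[OF assms] by simp
  moreover from this have "f = mk_fun X (app f)"
    using h(1) mk_fun_cong[of X "app f" h] by simp
  ultimately show "f = mk_fun X (app f) \<and> (\<forall>x\<in>X. app f x \<in> Z) \<and>
    (\<forall>x\<in>X. \<forall>y\<in>X. leX x y \<longrightarrow> leZ (app f x) (app f y))"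
    using h by auto
next
  assume "f = mk_fun X (app f) \<and> (\<forall>x\<in>X. app f x \<in> Z) \<and>
    (\<forall>x\<in>X. \<forall>y\<in>X. leX x y \<longrightarrow> leZ (app f x) (app f y))"
  then show "f \<in> mono_maps X leX Z leZ"
    unfolding mono_maps_def by blast
qed

lemma mk_fun_in_mono_maps:
  assumes "\<And>x. x \<in> X \<Longrightarrow> f x \<in> Z"
    and "\<And>x y. x \<in> X \<Longrightarrow> y \<in> X \<Longrightarrow> leX x y \<Longrightarrow> leZ (f x) (f y)"
  shows "mk_fun X f \<in> mono_maps X leX Z leZ"
  using assms unfolding mono_maps_def by blast

lemma finite_mono_maps:
  assumes "finite X" "finite Z"
  shows "finite (mono_maps X leX Z leZ)"
proof (rule finite_subset)
  show "mono_maps X leX Z leZ \<subseteq> mk_fun X ` (X \<rightarrow>\<^sub>E Z)"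
  proof
    fix g assume "g \<in> mono_maps X leX Z leZ"
    then obtain h where h: "g = mk_fun X h" "h \<in> X \<rightarrow> Z"
      unfolding mono_maps_def by auto
    \<comment> \<open>Restricting \<open>h\<close> keeps the graph and lands in the extensional
      function space, which is finite.\<close>
    have "g = mk_fun X (restrict h X)" "restrict h X \<in> X \<rightarrow>\<^sub>E Z"
      using h mk_fun_cong[of X h "restrict h X"] by auto
    then show "g \<in> mk_fun X ` (X \<rightarrow>\<^sub>E Z)" by blast
  qed
  show "finite (mk_fun X ` (X \<rightarrow>\<^sub>E Z))"
    using assms by (simp add: finite_PiE)
qed

lemma greatest_in_eqI:
  assumes "x \<in> X" "\<And>y. y \<in> X \<Longrightarrow> le y x" "\<And>y. y \<in> X \<Longrightarrow> le x y \<Longrightarrow> le y x \<Longrightarrow> y = x"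
  shows "greatest_in le X = x"
  unfolding greatest_in_def using assms by (intro the_equality) auto

lemma least_in_eqI:
  assumes "x \<in> X" "\<And>y. y \<in> X \<Longrightarrow> le x y" "\<And>y. y \<in> X \<Longrightarrow> le x y \<Longrightarrow> le y x \<Longrightarrow> y = x"
  shows "least_in le X = x"
  unfolding least_in_def using assms by (intro the_equality) auto

text \<open>Monotonicity and \<open>le (f u) u\<close> make the iterates decrease; finiteness forces
  a repetition, and antisymmetry collapses the resulting cycle to a fixpoint. The order is an
  arbitrary relation on \<open>X\<close>, so that the converse order covers increasing
  iterates.\<close>

lemma decreasing_iterates_stabilise:
  fixes f :: "'a \<Rightarrow> 'a"
  assumes "finite X" and u: "u \<in> X" "le (f u) u"
    and f: "\<And>x. x \<in> X \<Longrightarrow> f x \<in> X" "\<And>x y. x \<in> X \<Longrightarrow> y \<in> X \<Longrightarrow> le x y \<Longrightarrow> le (f x) (f y)"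
    and refl: "\<And>x. x \<in> X \<Longrightarrow> le x x"
    and trans: "\<And>x y z. x \<in> X \<Longrightarrow> y \<in> X \<Longrightarrow> z \<in> X \<Longrightarrow> le x y \<Longrightarrow> le y z \<Longrightarrow> le x z"
    and antisym: "\<And>x y. x \<in> X \<Longrightarrow> y \<in> X \<Longrightarrow> le x y \<Longrightarrow> le y x \<Longrightarrow> x = y"
  shows "\<exists>N. f ((f ^^ N) u) = (f ^^ N) u \<and> (\<forall>n. le ((f ^^ N) u) ((f ^^ n) u))"
proof -
  define s where "s n = (f ^^ n) u" for n
  have X: "s n \<in> X" for n
    unfolding s_def by (induction n) (auto intro: u f)
  have s_Suc: "s (Suc n) = f (s n)" for n
    unfolding s_def by simp
  have step: "le (s (Suc n)) (s n)" for n
  proof (induction n)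
    case 0
    then show ?case using u by (simp add: s_def)
  next
    case (Suc n)
    then show ?case using f(2)[OF X X, of "Suc n" n] s_Suc by simp
  qed
  have dec: "le (s (i + j)) (s i)" for i j
  proof (induction j)
    case (Suc j)
    then show ?case using trans[OF X X X step, of "i + j" i] by simp
  qed (simp add: refl X)
  have "\<not> inj s"
    using finite_subset[of "range s" X] X \<open>finite X\<close> finite_imageD[of s UNIV] by auto
  then obtain i j where ij: "i < j" "s i = s j"
    unfolding inj_def by (metis linorder_neqE_nat)
  then obtain l where "j = Suc i + l"
    by (metis less_iff_Suc_add add_Suc)
  \<comment> \<open>The repeated value \<open>s i = s j\<close> lies below \<open>s (Suc i)\<close>,
    because \<open>j\<close> is at least \<open>Suc i\<close>.\<close>
  then have "le (s i) (s (Suc i))"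
    using dec[of "Suc i" l] ij(2) by simp
  then have fixed: "f (s i) = s i"
    using antisym[OF X X] step s_Suc by metis
  have "s (i + n) = s i" for n
    by (induction n) (auto simp: s_Suc fixed)
  then have "le (s i) (s n)" for n
    by (metis dec le_iff_add linear)
  then show ?thesis
    using fixed unfolding s_def by blast
qed

lemma finite_FV: "finite (FV M)"
  by (induction M) auto

lemma snd_pick_fresh: "snd (pick_fresh v F) = snd v"
  unfolding pick_fresh_def by simp

text \<open>Each type has infinitely many names, so a finite set misses one of them and the
  \<open>LEAST\<close> is attained.\<close>

lemma pick_fresh_fresh:
  assumes "finite F"
  shows "pick_fresh v F \<notin> F"
proof -
  have "\<exists>n. (n, snd v) \<notin> F"
  proof (rule ccontr)
    assume "\<nexists>n. (n, snd v) \<notin> F"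
    then have "range (\<lambda>n::nat. (n, snd v)) \<subseteq> F" by auto
    then show False using assms finite_subset finite_imageD[of "\<lambda>n::nat. (n, snd v)" UNIV]
      by (auto simp: inj_on_def)
  qed
  then show ?thesis
    unfolding pick_fresh_def using LeastI_ex[of "\<lambda>n. (n, snd v) \<notin> F"] by simp
qed

context
  fixes Q :: "'q set" and \<rho> :: "'q \<Rightarrow> nat"
  assumes fin: "finite Q"
begin

abbreviation (input) D where "D \<equiv> Dom Q \<rho>"
abbreviation (input) le where "le \<equiv> dle Q \<rho>"
abbreviation (input) L where "L k \<equiv> Lrel Q \<rho> (Suc k)"
abbreviation (input) Fix where "Fix \<equiv> fixpt Q \<rho>"

subsection \<open>The domains and the relation between consecutive levels\<close>

text \<open>For natural numbers \<open>\<rho> q = 0\<close> and \<open>\<rho> q \<le> 0\<close>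
  coincide, so level 0 fits the pattern of the other levels.\<close>

lemma Dom_Ground: "D k \<o> = Base ` Pow (Q_le Q \<rho> k)"
  by (cases k) (auto simp: Q_le_def Q_eq_def)

text \<open>At level 0 this is an equality; above it a monotone map must also have a companion one
  level below.\<close>

lemma Dom_Arr_subset: "D k (A \<Rrightarrow> B) \<subseteq> mono_maps (D k A) (le k A) (D k B) (le k B)"
  by (cases k) auto

lemma finite_Dom: "finite (D k A)"
proof (induction A)
  case Ground
  show ?case using fin by (simp add: Dom_Ground Q_le_def)
next
  case (Arr A B)
  then show ?case using Dom_Arr_subset finite_mono_maps finite_subset by metis
qed

lemmas app_mk_fun_Dom = app_mk_fun[OF finite_Dom]

lemma Dom_ArrD:
  assumes "f \<in> D k (A \<Rrightarrow> B)"
  shows "f = mk_fun (D k A) (app f)"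
    and "x \<in> D k A \<Longrightarrow> app f x \<in> D k B"
    and "x \<in> D k A \<Longrightarrow> y \<in> D k A \<Longrightarrow> le k A x y \<Longrightarrow> le k B (app f x) (app f y)"
proof -
  have "f \<in> mono_maps (D k A) (le k A) (D k B) (le k B)"
    using assms Dom_Arr_subset by blast
  then show "f = mk_fun (D k A) (app f)"
    and "x \<in> D k A \<Longrightarrow> app f x \<in> D k B"
    and "x \<in> D k A \<Longrightarrow> y \<in> D k A \<Longrightarrow> le k A x y \<Longrightarrow> le k B (app f x) (app f y)"
    unfolding mono_maps_iff[OF finite_Dom] by blast+
qed

lemma dle_refl: "x \<in> D k A \<Longrightarrow> le k A x x"
proof (induction A arbitrary: x)
  case Ground
  then show ?case by (auto simp: Dom_Ground base_le_def)
next
  case (Arr A B)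
  then show ?case using Dom_ArrD(2) by auto
qed

lemma dle_trans:
  "\<lbrakk>x \<in> D k A; y \<in> D k A; z \<in> D k A; le k A x y; le k A y z\<rbrakk> \<Longrightarrow> le k A x z"
proof (induction A arbitrary: x y z)
  case Ground
  then show ?case by (auto simp: base_le_def)
next
  case (Arr A B)
  show ?case
    unfolding dle.simps
  proof
    fix a assume "a \<in> D k A"
    then show "le k B (app x a) (app z a)"
      using Arr.IH(2)[of "app x a" "app y a" "app z a"] Arr.prems Dom_ArrD(2) by auto
  qed
qed

lemma dle_antisym: "\<lbrakk>x \<in> D k A; y \<in> D k A; le k A x y; le k A y x\<rbrakk> \<Longrightarrow> x = y"
proof (induction A arbitrary: x y)
  case Ground
  then show ?case by (auto simp: base_le_def)
next
  case (Arr A B)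
  have "app x a = app y a" if "a \<in> D k A" for a
    using Arr.IH(2)[of "app x a" "app y a"] Arr.prems Dom_ArrD(2) that by auto
  then show ?case
    using Dom_ArrD(1)[OF Arr.prems(1)] Dom_ArrD(1)[OF Arr.prems(2)] mk_fun_cong by metis
qed

lemma Lrel_Ground:
  "(d, e) \<in> L k \<o> \<longleftrightarrow> (\<exists>P \<subseteq> Q_le Q \<rho> (Suc k). e = Base P \<and> d = Base (P \<inter> Q_le Q \<rho> k))"
  by (auto simp: Dom_Ground)

lemma LrelD: "(d, e) \<in> L k A \<Longrightarrow> d \<in> D k A \<and> e \<in> D (Suc k) A"
  by (cases A) auto

lemma Lrel_app: "(f1, f2) \<in> L k (A \<Rrightarrow> B) \<Longrightarrow> (x1, x2) \<in> L k A \<Longrightarrow> (app f1 x1, app f2 x2) \<in> L k B"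
  by auto

lemma Lrel_total: "e \<in> D (Suc k) A \<Longrightarrow> \<exists>d. (d, e) \<in> L k A"
  by (cases A) (auto simp: Dom_Ground Q_le_def)

text \<open>Membership in \<open>Dom\<close> at a successor level demands a companion one level
  below, so it is established by exhibiting related pairs. This introduction rule serves the lifts,
  the fixpoint combinators and abstractions.\<close>

lemma Lrel_mk_fun:
  assumes "mk_fun (D k A) g1 \<in> D k (A \<Rrightarrow> B)"
    and "\<And>x. x \<in> D (Suc k) A \<Longrightarrow> g2 x \<in> D (Suc k) B"
    and "\<And>x y. x \<in> D (Suc k) A \<Longrightarrow> y \<in> D (Suc k) A \<Longrightarrow> le (Suc k) A x y \<Longrightarrow> le (Suc k) B (g2 x) (g2 y)"
    and "\<And>x1 x2. (x1, x2) \<in> L k A \<Longrightarrow> (g1 x1, g2 x2) \<in> L k B"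
  shows "(mk_fun (D k A) g1, mk_fun (D (Suc k) A) g2) \<in> L k (A \<Rrightarrow> B)"
proof -
  have "(app (mk_fun (D k A) g1) x1, app (mk_fun (D (Suc k) A) g2) x2) \<in> L k B"
    if "(x1, x2) \<in> L k A" for x1 x2
    using assms(4)[OF that] LrelD[OF that] by (simp add: app_mk_fun_Dom)
  moreover have "mk_fun (D (Suc k) A) g2 \<in>
      mono_maps (D (Suc k) A) (le (Suc k) A) (D (Suc k) B) (le (Suc k) B)"
    using assms(2,3) by (rule mk_fun_in_mono_maps)
  ultimately show ?thesis using assms(1) by (auto simp del: Dom.simps)
qed

text \<open>
  The three clauses are proved together because each needs the others at smaller types: comparing
  the values of \<open>d\<close> and \<open>d'\<close> at an argument needs some element of the fibre over it, and the extremal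
  lifts of \<open>f\<close> at an arrow type are \<open>x \<mapsto> (f(x\<^sup>\<down>))\<^sup>\<up>\<close>, whose monotonicity needs that of \<open>\<down>\<close>.
\<close>

lemma fibres:
  "(\<forall>d e d' e'. (d, e) \<in> L k A \<longrightarrow> (d', e') \<in> L k A \<longrightarrow> le (Suc k) A e e' \<longrightarrow> le k A d d') \<and>
   (\<exists>u. \<forall>d\<in>D k A. (d, u d) \<in> L k A \<and>
      (\<forall>d' e. (d', e) \<in> L k A \<longrightarrow> le k A d' d \<longrightarrow> le (Suc k) A e (u d))) \<and>
   (\<exists>u. \<forall>d\<in>D k A. (d, u d) \<in> L k A \<and>
      (\<forall>d' e. (d', e) \<in> L k A \<longrightarrow> le k A d d' \<longrightarrow> le (Suc k) A (u d) e))"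
proof (induction A)
  case Ground
  have sub: "Q_le Q \<rho> k \<subseteq> Q_le Q \<rho> (Suc k)" by (auto simp: Q_le_def)
  \<comment> \<open>The greatest lift adds every state of rank exactly \<open>Suc k\<close>.\<close>
  let ?u = "\<lambda>d. case d of Base R \<Rightarrow> Base (R \<union> (Q_le Q \<rho> (Suc k) - Q_le Q \<rho> k))"
  have 1: "le k \<o> d d'" if "(d, e) \<in> L k \<o>" "(d', e') \<in> L k \<o>" "le (Suc k) \<o> e e'" for d e d' e'
    using that unfolding Lrel_Ground by (auto simp: base_le_def)
  have "(d, ?u d) \<in> L k \<o>" if d: "d \<in> D k \<o>" for d
  proof -
    obtain R where R: "d = Base R" "R \<subseteq> Q_le Q \<rho> k" using d unfolding Dom_Ground by blast
    then show ?thesis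
      unfolding Lrel_Ground using sub by (intro exI[where x = "R \<union> (Q_le Q \<rho> (Suc k) - Q_le Q \<rho> k)"]) auto
  qed
  moreover have "le (Suc k) \<o> e (?u d)" if "(d', e) \<in> L k \<o>" "le k \<o> d' d" for d d' e
    using that unfolding Lrel_Ground by (auto simp: base_le_def)
  ultimately have 2: "\<exists>u. \<forall>d\<in>D k \<o>. (d, u d) \<in> L k \<o> \<and>
      (\<forall>d' e. (d', e) \<in> L k \<o> \<longrightarrow> le k \<o> d' d \<longrightarrow> le (Suc k) \<o> e (u d))"
    by (intro exI[where x = ?u]) blast
  \<comment> \<open>The least lift adds no state, so \<open>d\<close> itself serves, read one level
    higher.\<close>
  have "(d, d) \<in> L k \<o>" if d: "d \<in> D k \<o>" for d
  proof -
    obtain R where R: "d = Base R" "R \<subseteq> Q_le Q \<rho> k" using d unfolding Dom_Ground by blast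
    then show ?thesis
      unfolding Lrel_Ground using sub by (intro exI[where x = "R"]) auto
  qed
  moreover have "le (Suc k) \<o> d e" if "(d', e) \<in> L k \<o>" "le k \<o> d d'" for d d' e
    using that unfolding Lrel_Ground by (auto simp: base_le_def)
  ultimately have 3: "\<exists>u. \<forall>d\<in>D k \<o>. (d, u d) \<in> L k \<o> \<and>
      (\<forall>d' e. (d', e) \<in> L k \<o> \<longrightarrow> le k \<o> d d' \<longrightarrow> le (Suc k) \<o> (u d) e)"
    by (intro exI[where x = "\<lambda>d. d"]) blast
  show ?case using 1 2 3 by blast
next
  case (Arr A B)
  obtain u where u: "\<And>d. d \<in> D k A \<Longrightarrow> (d, u d) \<in> L k A"
    using Arr.IH(1) by blast
  have monA: "le k A d d'" if "(d, e) \<in> L k A" "(d', e') \<in> L k A" "le (Suc k) A e e'" for d e d' e'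
    using Arr.IH(1) that by blast
  have monB: "le k B d d'" if "(d, e) \<in> L k B" "(d', e') \<in> L k B" "le (Suc k) B e e'" for d e d' e'
    using Arr.IH(2) that by blast
  \<comment> \<open>The projection at type \<open>A\<close> is picked by choice; that it is the only
    one follows from the monotonicity clause for \<open>A\<close>.\<close>
  define p where "p x = (SOME d. (d, x) \<in> L k A)" for x
  have p: "(p x, x) \<in> L k A" if "x \<in> D (Suc k) A" for x
    unfolding p_def using someI_ex[OF Lrel_total[OF that]] .
  have p_Dom: "p x \<in> D k A" if "x \<in> D (Suc k) A" for x
    using LrelD[OF p[OF that]] by simp
  have p_unique: "x1 = p x2" if "(x1, x2) \<in> L k A" for x1 x2
  proof -
    have x2: "x2 \<in> D (Suc k) A" "x1 \<in> D k A" using LrelD[OF that] by auto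
    show ?thesis
      using dle_antisym[OF x2(2) p_Dom[OF x2(1)]]
        monA[OF that p[OF x2(1)] dle_refl[OF x2(1)]] monA[OF p[OF x2(1)] that dle_refl[OF x2(1)]] .
  qed
  have p_mono: "le k A (p x) (p y)"
    if "x \<in> D (Suc k) A" "y \<in> D (Suc k) A" "le (Suc k) A x y" for x y
    using monA p that by blast
  have 1: "le k (A \<Rrightarrow> B) d d'"
    if "(d, e) \<in> L k (A \<Rrightarrow> B)" "(d', e') \<in> L k (A \<Rrightarrow> B)" "le (Suc k) (A \<Rrightarrow> B) e e'" for d e d' e'
    unfolding dle.simps
  proof
    fix x assume x: "x \<in> D k A"
    have "le (Suc k) B (app e (u x)) (app e' (u x))"
      using that(3) u[OF x] LrelD by simp
    then show "le k B (app d x) (app d' x)"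
      using monB Lrel_app[OF that(1) u[OF x]] Lrel_app[OF that(2) u[OF x]] by blast
  qed
  \<comment> \<open>Any monotone section \<open>v\<close> of the fibres at \<open>B\<close> induces
    a lift at the arrow type. It is used twice, with the greatest and with the least lift at
    \<open>B\<close>.\<close>
  have lift: "(f, mk_fun (D (Suc k) A) (\<lambda>x. v (app f (p x)))) \<in> L k (A \<Rrightarrow> B)"
    if f: "f \<in> D k (A \<Rrightarrow> B)" and v: "\<And>d. d \<in> D k B \<Longrightarrow> (d, v d) \<in> L k B"
      "\<And>d d'. d \<in> D k B \<Longrightarrow> d' \<in> D k B \<Longrightarrow> le k B d d' \<Longrightarrow> le (Suc k) B (v d) (v d')" for f v
  proof -
    have "(mk_fun (D k A) (app f), mk_fun (D (Suc k) A) (\<lambda>x. v (app f (p x)))) \<in> L k (A \<Rrightarrow> B)"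
    proof (rule Lrel_mk_fun)
      show "mk_fun (D k A) (app f) \<in> D k (A \<Rrightarrow> B)" using f Dom_ArrD(1)[OF f] by simp
      show "v (app f (p x)) \<in> D (Suc k) B" if "x \<in> D (Suc k) A" for x
        using LrelD[OF v(1)[OF Dom_ArrD(2)[OF f p_Dom[OF that]]]] by simp
      show "le (Suc k) B (v (app f (p x))) (v (app f (p y)))"
        if "x \<in> D (Suc k) A" "y \<in> D (Suc k) A" "le (Suc k) A x y" for x y
        using v(2) Dom_ArrD(2,3)[OF f] p_Dom p_mono that by simp
      show "(app f x1, v (app f (p x2))) \<in> L k B" if "(x1, x2) \<in> L k A" for x1 x2
        using v(1) Dom_ArrD(2)[OF f] p_unique[OF that] LrelD[OF that] by simp
    qed
    then show ?thesis using Dom_ArrD(1)[OF f] by simp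
  qed
  from Arr.IH(2)[THEN conjunct2, THEN conjunct1]
  obtain v where v_all: "\<forall>d\<in>D k B. (d, v d) \<in> L k B \<and>
      (\<forall>d' e. (d', e) \<in> L k B \<longrightarrow> le k B d' d \<longrightarrow> le (Suc k) B e (v d))" ..
  have v1: "(d, v d) \<in> L k B" if "d \<in> D k B" for d
    using v_all[rule_format, OF that] by (rule conjunct1)
  have v2: "le (Suc k) B e (v d)" if "d \<in> D k B" "(d', e) \<in> L k B" "le k B d' d" for d d' e
    using v_all[rule_format, OF that(1), THEN conjunct2] that(2,3) by blast
  \<comment> \<open>Since \<open>v2\<close> bounds elements over anything below \<open>d\<close>,
    not only over \<open>d\<close>, applying it to a value of \<open>v\<close> itself yields the
    monotonicity of \<open>v\<close> that \<open>lift\<close> requires.\<close>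
  have v_lift: "(f, mk_fun (D (Suc k) A) (\<lambda>x. v (app f (p x)))) \<in> L k (A \<Rrightarrow> B)"
    if "f \<in> D k (A \<Rrightarrow> B)" for f
    using that by (rule lift) (auto intro: v1 v2 simp del: Dom.simps dle.simps Lrel.simps)
  have "le (Suc k) (A \<Rrightarrow> B) e (mk_fun (D (Suc k) A) (\<lambda>x. v (app f (p x))))"
    if "f \<in> D k (A \<Rrightarrow> B)" "(d', e) \<in> L k (A \<Rrightarrow> B)" "le k (A \<Rrightarrow> B) d' f" for f d' e
    unfolding dle.simps
  proof
    fix x assume x: "x \<in> D (Suc k) A"
    have "le k B (app d' (p x)) (app f (p x))" using that(3) p_Dom[OF x] by simp
    then show "le (Suc k) B (app e x) (app (mk_fun (D (Suc k) A) (\<lambda>x. v (app f (p x)))) x)"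
      using v2[OF Dom_ArrD(2)[OF that(1) p_Dom[OF x]] Lrel_app[OF that(2) p[OF x]]] x
      by (simp add: app_mk_fun_Dom)
  qed
  then have 2: "\<exists>u. \<forall>d\<in>D k (A \<Rrightarrow> B). (d, u d) \<in> L k (A \<Rrightarrow> B) \<and>
      (\<forall>d' e. (d', e) \<in> L k (A \<Rrightarrow> B) \<longrightarrow> le k (A \<Rrightarrow> B) d' d \<longrightarrow> le (Suc k) (A \<Rrightarrow> B) e (u d))"
    by (intro exI[where x = "\<lambda>f. mk_fun (D (Suc k) A) (\<lambda>x. v (app f (p x)))"]) (use v_lift in blast)
  from Arr.IH(2)[THEN conjunct2, THEN conjunct2]
  obtain w where w_all: "\<forall>d\<in>D k B. (d, w d) \<in> L k B \<and>
      (\<forall>d' e. (d', e) \<in> L k B \<longrightarrow> le k B d d' \<longrightarrow> le (Suc k) B (w d) e)" ..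
  have w1: "(d, w d) \<in> L k B" if "d \<in> D k B" for d
    using w_all[rule_format, OF that] by (rule conjunct1)
  have w2: "le (Suc k) B (w d) e" if "d \<in> D k B" "(d', e) \<in> L k B" "le k B d d'" for d d' e
    using w_all[rule_format, OF that(1), THEN conjunct2] that(2,3) by blast
  have w_lift: "(f, mk_fun (D (Suc k) A) (\<lambda>x. w (app f (p x)))) \<in> L k (A \<Rrightarrow> B)"
    if "f \<in> D k (A \<Rrightarrow> B)" for f
    using that by (rule lift) (auto intro: w1 w2 simp del: Dom.simps dle.simps Lrel.simps)
  have "le (Suc k) (A \<Rrightarrow> B) (mk_fun (D (Suc k) A) (\<lambda>x. w (app f (p x)))) e"
    if "f \<in> D k (A \<Rrightarrow> B)" "(d', e) \<in> L k (A \<Rrightarrow> B)" "le k (A \<Rrightarrow> B) f d'" for f d' e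
    unfolding dle.simps
  proof
    fix x assume x: "x \<in> D (Suc k) A"
    have "le k B (app f (p x)) (app d' (p x))" using that(3) p_Dom[OF x] by simp
    then show "le (Suc k) B (app (mk_fun (D (Suc k) A) (\<lambda>x. w (app f (p x)))) x) (app e x)"
      using w2[OF Dom_ArrD(2)[OF that(1) p_Dom[OF x]] Lrel_app[OF that(2) p[OF x]]] x
      by (simp add: app_mk_fun_Dom)
  qed
  then have 3: "\<exists>u. \<forall>d\<in>D k (A \<Rrightarrow> B). (d, u d) \<in> L k (A \<Rrightarrow> B) \<and>
      (\<forall>d' e. (d', e) \<in> L k (A \<Rrightarrow> B) \<longrightarrow> le k (A \<Rrightarrow> B) d d' \<longrightarrow> le (Suc k) (A \<Rrightarrow> B) (u d) e)"
    by (intro exI[where x = "\<lambda>f. mk_fun (D (Suc k) A) (\<lambda>x. w (app f (p x)))"]) (use w_lift in blast)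
  show ?case using 1 2 3 by blast
qed

section \<open>The projection and the extremal lifts as functions\<close>

lemma Lrel_mono:
  "(d, e) \<in> L k A \<Longrightarrow> (d', e') \<in> L k A \<Longrightarrow> le (Suc k) A e e' \<Longrightarrow> le k A d d'"
  using fibres by blast

text \<open>Comparing \<open>e\<close> with itself in both directions puts \<open>d\<close> and
  \<open>d'\<close> below each other.\<close>

lemma Lrel_unique: "(d, e) \<in> L k A \<Longrightarrow> (d', e) \<in> L k A \<Longrightarrow> d = d'"
  by (meson LrelD Lrel_mono dle_antisym dle_refl)

lemma down_eq: "(d, e) \<in> L k A \<Longrightarrow> down Q \<rho> k A e = d"
  unfolding down_def by (rule the_equality) (auto dest: LrelD Lrel_unique)

lemma Lrel_down: "e \<in> D (Suc k) A \<Longrightarrow> (down Q \<rho> k A e, e) \<in> L k A"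
  using Lrel_total down_eq by metis

text \<open>The second clause compares across fibres: with \<open>d' = d\<close> it says that the
  lift is greatest in its fibre, and applied to another lift it gives monotonicity in
  \<open>d\<close>. The fixpoint lemmas use both.\<close>

lemma up_top:
  assumes "d \<in> D k A"
  shows "(d, up_top Q \<rho> (Suc k) A d) \<in> L k A"
    and "(d', e) \<in> L k A \<Longrightarrow> le k A d' d \<Longrightarrow> le (Suc k) A e (up_top Q \<rho> (Suc k) A d)"
proof -
  from fibres[of k A, THEN conjunct2, THEN conjunct1]
  obtain v where "\<forall>d\<in>D k A. (d, v d) \<in> L k A \<and>
      (\<forall>d' e. (d', e) \<in> L k A \<longrightarrow> le k A d' d \<longrightarrow> le (Suc k) A e (v d))" ..
  from bspec[OF this assms] obtain u where u: "(d, u) \<in> L k A"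
    "\<And>d' e. (d', e) \<in> L k A \<Longrightarrow> le k A d' d \<Longrightarrow> le (Suc k) A e u"
    by blast
  have "up_top Q \<rho> (Suc k) A d = u"
    unfolding up_top_def
  proof (rule greatest_in_eqI)
    show "u \<in> {e. (d, e) \<in> L k A}" using u(1) by blast
    show "le (Suc k) A e u" if "e \<in> {e. (d, e) \<in> L k A}" for e
      using that u(2) dle_refl[OF assms] by blast
    show "e = u" if "e \<in> {e. (d, e) \<in> L k A}" "le (Suc k) A u e" "le (Suc k) A e u" for e
      using that dle_antisym LrelD u(1) by blast
  qed
  then show "(d, up_top Q \<rho> (Suc k) A d) \<in> L k A"
    and "(d', e) \<in> L k A \<Longrightarrow> le k A d' d \<Longrightarrow> le (Suc k) A e (up_top Q \<rho> (Suc k) A d)"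
    using u by auto
qed

lemma up_bot:
  assumes "d \<in> D k A"
  shows "(d, up_bot Q \<rho> (Suc k) A d) \<in> L k A"
    and "(d', e) \<in> L k A \<Longrightarrow> le k A d d' \<Longrightarrow> le (Suc k) A (up_bot Q \<rho> (Suc k) A d) e"
proof -
  from fibres[of k A, THEN conjunct2, THEN conjunct2]
  obtain v where "\<forall>d\<in>D k A. (d, v d) \<in> L k A \<and>
      (\<forall>d' e. (d', e) \<in> L k A \<longrightarrow> le k A d d' \<longrightarrow> le (Suc k) A (v d) e)" ..
  from bspec[OF this assms] obtain u where u: "(d, u) \<in> L k A"
    "\<And>d' e. (d', e) \<in> L k A \<Longrightarrow> le k A d d' \<Longrightarrow> le (Suc k) A u e"
    by blast
  have "up_bot Q \<rho> (Suc k) A d = u"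
    unfolding up_bot_def
  proof (rule least_in_eqI)
    show "u \<in> {e. (d, e) \<in> L k A}" using u(1) by blast
    show "le (Suc k) A u e" if "e \<in> {e. (d, e) \<in> L k A}" for e
      using that u(2) dle_refl[OF assms] by blast
    show "e = u" if "e \<in> {e. (d, e) \<in> L k A}" "le (Suc k) A u e" "le (Suc k) A e u" for e
      using that dle_antisym LrelD u(1) by blast
  qed
  then show "(d, up_bot Q \<rho> (Suc k) A d) \<in> L k A"
    and "(d', e) \<in> L k A \<Longrightarrow> le k A d d' \<Longrightarrow> le (Suc k) A (up_bot Q \<rho> (Suc k) A d) e"
    using u by auto
qed

subsection \<open>Fixpoints\<close>

lemma mk_fun_in_Dom_0:
  assumes "\<And>x. x \<in> D 0 A \<Longrightarrow> f x \<in> D 0 B"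
    and "\<And>x y. x \<in> D 0 A \<Longrightarrow> y \<in> D 0 A \<Longrightarrow> le 0 A x y \<Longrightarrow> le 0 B (f x) (f y)"
  shows "mk_fun (D 0 A) f \<in> D 0 (A \<Rrightarrow> B)"
  using mk_fun_in_mono_maps[of "D 0 A" f "D 0 B" "le 0 A" "le 0 B"] assms by simp

lemma ex_top_0: "\<exists>t\<in>D 0 A. \<forall>x\<in>D 0 A. le 0 A x t"
proof (induction A)
  case Ground
  show ?case by (auto simp: Dom_Ground base_le_def)
next
  case (Arr A B)
  then obtain t where t: "t \<in> D 0 B" "\<forall>x\<in>D 0 B. le 0 B x t" by blast
  have "mk_fun (D 0 A) (\<lambda>_. t) \<in> D 0 (A \<Rrightarrow> B)"
    using t dle_refl by (intro mk_fun_in_Dom_0) auto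
  moreover have "le 0 (A \<Rrightarrow> B) f (mk_fun (D 0 A) (\<lambda>_. t))" if "f \<in> D 0 (A \<Rrightarrow> B)" for f
    using that t Dom_ArrD(2)[OF that] by (simp add: app_mk_fun_Dom)
  ultimately show ?case by blast
qed

lemma top_el_0:
  shows "top_el Q \<rho> 0 A \<in> D 0 A" and "x \<in> D 0 A \<Longrightarrow> le 0 A x (top_el Q \<rho> 0 A)"
proof -
  obtain t where t: "t \<in> D 0 A" "\<forall>x\<in>D 0 A. le 0 A x t" using ex_top_0 by blast
  have "top_el Q \<rho> 0 A = t"
    unfolding top_el_def using t dle_antisym by (intro greatest_in_eqI) auto
  then show "top_el Q \<rho> 0 A \<in> D 0 A" and "x \<in> D 0 A \<Longrightarrow> le 0 A x (top_el Q \<rho> 0 A)"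
    using t by auto
qed

text \<open>Lifting carries an element from each level to the next. Nonemptiness later allows a
  valuation to be extended to all variables.\<close>

lemma Dom_nonempty: "\<exists>x. x \<in> D k A"
proof (induction k)
  case 0
  show ?case using top_el_0 by blast
next
  case (Suc k)
  then show ?case using up_top(1) LrelD by blast
qed

lemma iterates_in_Dom:
  "f \<in> D k (A \<Rrightarrow> A) \<Longrightarrow> u \<in> D k A \<Longrightarrow> (app f ^^ n) u \<in> D k A"
  by (induction n) (auto intro: Dom_ArrD(2) simp del: Dom.simps)

lemma iterates_mono:
  assumes "f \<in> D k (A \<Rrightarrow> A)" "g \<in> D k (A \<Rrightarrow> A)" "le k (A \<Rrightarrow> A) f g"
    and "u \<in> D k A" "v \<in> D k A" "le k A u v"
  shows "le k A ((app f ^^ n) u) ((app g ^^ n) v)"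
proof (induction n)
  case (Suc n)
  let ?x = "(app f ^^ n) u" and ?y = "(app g ^^ n) v"
  have x: "?x \<in> D k A" and y: "?y \<in> D k A"
    using iterates_in_Dom assms by blast+
  have "le k A (app f ?x) (app f ?y)"
    using Dom_ArrD(3)[OF assms(1) x y Suc] .
  moreover have "le k A (app f ?y) (app g ?y)"
    using assms(3) y by simp
  ultimately show ?case
    using dle_trans[OF Dom_ArrD(2)[OF assms(1) x] Dom_ArrD(2)[OF assms(1) y] Dom_ArrD(2)[OF assms(2) y]]
    by simp
qed (simp add: assms)

text \<open>The stable iterate is a lower bound of the iterates and also one of them, hence their
  greatest lower bound; the existence of meets of arbitrary sets does not enter.\<close>

lemma meet_iterates:
  assumes f: "f \<in> D k (A \<Rrightarrow> A)" and u: "u \<in> D k A" "le k A (app f u) u"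
  obtains N where "meet Q \<rho> k A {(app f ^^ n) u | n. True} = (app f ^^ N) u"
    and "app f ((app f ^^ N) u) = (app f ^^ N) u"
    and "\<And>n. le k A ((app f ^^ N) u) ((app f ^^ n) u)"
proof -
  have "\<exists>N. app f ((app f ^^ N) u) = (app f ^^ N) u \<and> (\<forall>n. le k A ((app f ^^ N) u) ((app f ^^ n) u))"
    by (rule decreasing_iterates_stabilise[of "D k A" u "le k A" "app f", OF finite_Dom u])
      (blast intro: Dom_ArrD(2,3)[OF f] dle_refl dle_trans dle_antisym)+
  then obtain N where N: "app f ((app f ^^ N) u) = (app f ^^ N) u" "\<And>n. le k A ((app f ^^ N) u) ((app f ^^ n) u)"
    by blast
  have "meet Q \<rho> k A {(app f ^^ n) u | n. True} = (app f ^^ N) u"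
    unfolding meet_def
  proof (rule greatest_in_eqI)
    show "(app f ^^ N) u \<in> {d \<in> D k A. \<forall>s\<in>{(app f ^^ n) u | n. True}. le k A d s}"
      using N(2) iterates_in_Dom[OF f u(1)] by blast
  qed (use iterates_in_Dom[OF f u(1)] dle_antisym in blast)+
  then show thesis using that N by blast
qed

lemma join_iterates:
  assumes f: "f \<in> D k (A \<Rrightarrow> A)" and u: "u \<in> D k A" "le k A u (app f u)"
  obtains N where "join Q \<rho> k A {(app f ^^ n) u | n. True} = (app f ^^ N) u"
    and "app f ((app f ^^ N) u) = (app f ^^ N) u"
    and "\<And>n. le k A ((app f ^^ n) u) ((app f ^^ N) u)"
proof -
  have "\<exists>N. app f ((app f ^^ N) u) = (app f ^^ N) u \<and> (\<forall>n. le k A ((app f ^^ n) u) ((app f ^^ N) u))"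
    \<comment> \<open>The converse order turns the increasing iterates into decreasing ones.\<close>
    by (rule decreasing_iterates_stabilise[of "D k A" u "\<lambda>x y. le k A y x" "app f", OF finite_Dom u])
      (blast intro: Dom_ArrD(2,3)[OF f] dle_refl dle_trans dle_antisym)+
  then obtain N where N: "app f ((app f ^^ N) u) = (app f ^^ N) u" "\<And>n. le k A ((app f ^^ n) u) ((app f ^^ N) u)"
    by blast
  have "join Q \<rho> k A {(app f ^^ n) u | n. True} = (app f ^^ N) u"
    unfolding join_def
  proof (rule least_in_eqI)
    show "(app f ^^ N) u \<in> {d \<in> D k A. \<forall>s\<in>{(app f ^^ n) u | n. True}. le k A s d}"
      using N(2) iterates_in_Dom[OF f u(1)] by blast
  qed (use iterates_in_Dom[OF f u(1)] dle_antisym in blast)+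
  then show thesis using that N by blast
qed

text \<open>Applying \<open>f2\<close> moves an element over \<open>d\<close> to one over
  \<open>app f1 d\<close>, which is \<open>d\<close> again.\<close>

lemma iterates_in_fibre:
  assumes "(f1, f2) \<in> L k (A \<Rrightarrow> A)" "app f1 d = d" "(d, u) \<in> L k A"
  shows "(d, (app f2 ^^ n) u) \<in> L k A"
proof (induction n)
  case (Suc n)
  then show ?case using Lrel_app[OF assms(1) Suc] assms(2) by simp
qed (simp add: assms)

text \<open>Both \<open>u\<close> and \<open>app f2 u\<close> lie over the fixpoint one level below,
  and \<open>u\<close> is greatest there, so the iterates decrease. The exponent and the bounds are
  recorded for the monotonicity of \<open>fixpt\<close>.\<close>

lemma fixpt_Suc_even:
  assumes f: "(f1, f2) \<in> L k (A \<Rrightarrow> A)"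
    and d: "Fix k A f1 \<in> D k A" "app f1 (Fix k A f1) = Fix k A f1"
    and "even (Suc k)"
  defines "u \<equiv> up_top Q \<rho> (Suc k) A (Fix k A f1)"
  obtains N where "Fix (Suc k) A f2 = (app f2 ^^ N) u"
    and "app f2 (Fix (Suc k) A f2) = Fix (Suc k) A f2"
    and "\<And>n. le (Suc k) A (Fix (Suc k) A f2) ((app f2 ^^ n) u)"
proof -
  have u: "(Fix k A f1, u) \<in> L k A" using up_top(1)[OF d(1)] u_def by simp
  have "(Fix k A f1, app f2 u) \<in> L k A" using Lrel_app[OF f u] d(2) by simp
  then have "le (Suc k) A (app f2 u) u"
    using up_top(2)[OF d(1)] dle_refl[OF d(1)] u_def by blast
  moreover have "Fix (Suc k) A f2 = meet Q \<rho> (Suc k) A {(app f2 ^^ n) u | n. True}"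
    using \<open>even (Suc k)\<close> down_eq[OF f] by (simp add: u_def)
  ultimately show thesis
    using meet_iterates[of f2 "Suc k" A u] LrelD[OF f] LrelD[OF u] that by metis
qed

lemma fixpt_Suc_odd:
  assumes f: "(f1, f2) \<in> L k (A \<Rrightarrow> A)"
    and d: "Fix k A f1 \<in> D k A" "app f1 (Fix k A f1) = Fix k A f1"
    and "odd (Suc k)"
  defines "u \<equiv> up_bot Q \<rho> (Suc k) A (Fix k A f1)"
  obtains N where "Fix (Suc k) A f2 = (app f2 ^^ N) u"
    and "app f2 (Fix (Suc k) A f2) = Fix (Suc k) A f2"
    and "\<And>n. le (Suc k) A ((app f2 ^^ n) u) (Fix (Suc k) A f2)"
proof -
  have u: "(Fix k A f1, u) \<in> L k A" using up_bot(1)[OF d(1)] u_def by simp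
  have "(Fix k A f1, app f2 u) \<in> L k A" using Lrel_app[OF f u] d(2) by simp
  then have "le (Suc k) A u (app f2 u)"
    using up_bot(2)[OF d(1)] dle_refl[OF d(1)] u_def by blast
  moreover have "Fix (Suc k) A f2 = join Q \<rho> (Suc k) A {(app f2 ^^ n) u | n. True}"
    using \<open>odd (Suc k)\<close> down_eq[OF f] by (simp add: u_def)
  ultimately show thesis
    using join_iterates[of f2 "Suc k" A u] LrelD[OF f] LrelD[OF u] that by metis
qed

lemma fixpt_Suc_Lrel:
  assumes f: "(f1, f2) \<in> L k (A \<Rrightarrow> A)"
    and d: "Fix k A f1 \<in> D k A" "app f1 (Fix k A f1) = Fix k A f1"
  shows "(Fix k A f1, Fix (Suc k) A f2) \<in> L k A"
    and "app f2 (Fix (Suc k) A f2) = Fix (Suc k) A f2"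
  using fixpt_Suc_even[OF f d] fixpt_Suc_odd[OF f d]
    iterates_in_fibre[OF f d(2) up_top(1)[OF d(1)]] iterates_in_fibre[OF f d(2) up_bot(1)[OF d(1)]]
  by metis+

text \<open>The claims need a joint induction on the level: at \<open>Suc k\<close> the iteration
  starts over a fixpoint from level \<open>k\<close>, and comparing the starting points of two
  iterations needs monotonicity at level \<open>k\<close>.\<close>

lemma fixpt:
  shows "f \<in> D k (A \<Rrightarrow> A) \<Longrightarrow> Fix k A f \<in> D k A \<and> app f (Fix k A f) = Fix k A f"
    and "f \<in> D k (A \<Rrightarrow> A) \<Longrightarrow> g \<in> D k (A \<Rrightarrow> A) \<Longrightarrow> le k (A \<Rrightarrow> A) f g \<Longrightarrow>
      le k A (Fix k A f) (Fix k A g)"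
proof (induction k arbitrary: f g)
  case 0
  have *: "\<exists>N. Fix 0 A f = (app f ^^ N) (top_el Q \<rho> 0 A) \<and> app f (Fix 0 A f) = Fix 0 A f \<and>
      (\<forall>n. le 0 A (Fix 0 A f) ((app f ^^ n) (top_el Q \<rho> 0 A)))" if f: "f \<in> D 0 (A \<Rrightarrow> A)" for f
  proof -
    obtain N where "meet Q \<rho> 0 A {(app f ^^ n) (top_el Q \<rho> 0 A) | n. True} = (app f ^^ N) (top_el Q \<rho> 0 A)"
      and "app f ((app f ^^ N) (top_el Q \<rho> 0 A)) = (app f ^^ N) (top_el Q \<rho> 0 A)"
      and "\<And>n. le 0 A ((app f ^^ N) (top_el Q \<rho> 0 A)) ((app f ^^ n) (top_el Q \<rho> 0 A))"
      using meet_iterates[OF f top_el_0(1) top_el_0(2)[OF Dom_ArrD(2)[OF f top_el_0(1)]]] by blast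
    then show ?thesis by auto
  qed
  { case 1
    then show ?case using *[OF 1] iterates_in_Dom[OF 1 top_el_0(1)] by metis
  next
    case 2
    \<comment> \<open>The fixpoint of \<open>f\<close> is below all iterates of \<open>f\<close>, so
      the exponent that computes the fixpoint of \<open>g\<close> can be used for both maps.\<close>
    obtain n where n: "Fix 0 A g = (app g ^^ n) (top_el Q \<rho> 0 A)" using *[OF 2(2)] by blast
    have "le 0 A (Fix 0 A f) ((app f ^^ n) (top_el Q \<rho> 0 A))" using *[OF 2(1)] by blast
    moreover have "le 0 A ((app f ^^ n) (top_el Q \<rho> 0 A)) ((app g ^^ n) (top_el Q \<rho> 0 A))"
      using iterates_mono[OF 2] top_el_0 by blast
    ultimately show ?case
      using dle_trans iterates_in_Dom[OF _ top_el_0(1)] 2(1,2) * n by metis }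
next
  case (Suc k)
  { case 1
    have L: "(down Q \<rho> k (A \<Rrightarrow> A) f, f) \<in> L k (A \<Rrightarrow> A)" using Lrel_down[OF 1] .
    show ?case using fixpt_Suc_Lrel[OF L] Suc.IH(1) LrelD[OF L] LrelD by blast
  next
    case 2
    define f1 where "f1 = down Q \<rho> k (A \<Rrightarrow> A) f"
    define g1 where "g1 = down Q \<rho> k (A \<Rrightarrow> A) g"
    let ?d = "Fix k A f1" and ?e = "Fix k A g1"
    have f: "(f1, f) \<in> L k (A \<Rrightarrow> A)" and g: "(g1, g) \<in> L k (A \<Rrightarrow> A)"
      using Lrel_down 2(1,2) unfolding f1_def g1_def by blast+
    have d: "?d \<in> D k A" "app f1 ?d = ?d" and e: "?e \<in> D k A" "app g1 ?e = ?e"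
      using Suc.IH(1) LrelD[OF f] LrelD[OF g] by blast+
    have de: "le k A ?d ?e"
      using Suc.IH(2) LrelD[OF f] LrelD[OF g] Lrel_mono[OF f g 2(3)] by blast
    have FD: "Fix (Suc k) A f \<in> D (Suc k) A" "Fix (Suc k) A g \<in> D (Suc k) A"
      using fixpt_Suc_Lrel(1)[OF f d] fixpt_Suc_Lrel(1)[OF g e] LrelD by blast+
    show ?case
    proof (cases "even (Suc k)")
      case True
      let ?u = "up_top Q \<rho> (Suc k) A ?d" and ?v = "up_top Q \<rho> (Suc k) A ?e"
      have uv: "?u \<in> D (Suc k) A" "?v \<in> D (Suc k) A" "le (Suc k) A ?u ?v"
        using up_top[OF d(1)] up_top[OF e(1)] de LrelD by blast+
      obtain n where n: "Fix (Suc k) A g = (app g ^^ n) ?v"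
        using fixpt_Suc_even[OF g e True] by metis
      have "le (Suc k) A (Fix (Suc k) A f) ((app f ^^ n) ?u)"
        using fixpt_Suc_even[OF f d True] by metis
      then show ?thesis
        using dle_trans[OF FD(1) iterates_in_Dom[OF 2(1) uv(1)] FD(2)] iterates_mono[OF 2 uv, of n] n
        by metis
    next
      case False
      let ?u = "up_bot Q \<rho> (Suc k) A ?d" and ?v = "up_bot Q \<rho> (Suc k) A ?e"
      have uv: "?u \<in> D (Suc k) A" "?v \<in> D (Suc k) A" "le (Suc k) A ?u ?v"
        using up_bot[OF d(1)] up_bot[OF e(1)] de LrelD by blast+
      \<comment> \<open>At odd levels the iterates increase, so the exponent now comes from
        \<open>f\<close>, the smaller map.\<close>
      obtain n where n: "Fix (Suc k) A f = (app f ^^ n) ?u"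
        using fixpt_Suc_odd[OF f d False] by metis
      have "le (Suc k) A ((app g ^^ n) ?v) (Fix (Suc k) A g)"
        using fixpt_Suc_odd[OF g e False] by metis
      then show ?thesis
        using dle_trans[OF FD(1) iterates_in_Dom[OF 2(2) uv(2)] FD(2)] iterates_mono[OF 2 uv, of n] n
        by metis
    qed }
qed

lemma fixpt_Lrel: "(f1, f2) \<in> L k (A \<Rrightarrow> A) \<Longrightarrow> (Fix k A f1, Fix (Suc k) A f2) \<in> L k A"
  using fixpt_Suc_Lrel(1) fixpt(1) LrelD by blast

lemma Ycomb_Lrel:
  assumes "mk_fun (D k (A \<Rrightarrow> A)) (Fix k A) \<in> D k ((A \<Rrightarrow> A) \<Rrightarrow> A)"
  shows "(mk_fun (D k (A \<Rrightarrow> A)) (Fix k A), mk_fun (D (Suc k) (A \<Rrightarrow> A)) (Fix (Suc k) A))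
    \<in> L k ((A \<Rrightarrow> A) \<Rrightarrow> A)"
  using assms fixpt[of _ "Suc k" A] fixpt_Lrel by (intro Lrel_mk_fun) blast+

lemma Ycomb_in_Dom: "mk_fun (D k (A \<Rrightarrow> A)) (Fix k A) \<in> D k ((A \<Rrightarrow> A) \<Rrightarrow> A)"
proof (induction k)
  case 0
  show ?case using fixpt[of _ 0 A] by (intro mk_fun_in_Dom_0) blast+
next
  case (Suc k)
  then show ?case using Ycomb_Lrel LrelD by blast
qed

subsection \<open>Interpretation of terms\<close>

lemma dle_app:
  assumes "f \<in> D k (A \<Rrightarrow> B)" "g \<in> D k (A \<Rrightarrow> B)" "le k (A \<Rrightarrow> B) f g"
    and "x \<in> D k A" "y \<in> D k A" "le k A x y"
  shows "le k B (app f x) (app g y)"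
  using dle_trans[OF Dom_ArrD(2)[OF assms(1,4)] Dom_ArrD(2)[OF assms(1,5)] Dom_ArrD(2)[OF assms(2,5)]
      Dom_ArrD(3)[OF assms(1,4,5,6)]] assms(3,5) by simp

text \<open>Covering every variable, rather than the free ones of a term, spares bookkeeping under
  binders and along conversions.\<close>

definition total_valuation :: "nat \<Rightarrow> (var \<Rightarrow> 'q val) \<Rightarrow> bool" where
  "total_valuation k \<nu> \<longleftrightarrow> (\<forall>v. \<nu> v \<in> D k (snd v))"

lemma total_valuation_upd:
  "total_valuation k \<nu> \<Longrightarrow> p \<in> D k A \<Longrightarrow> total_valuation k (\<nu>((x, A) := p))"
  by (auto simp: total_valuation_def)

text \<open>Membership and monotonicity in the valuation are proved together, because an abstraction
  belongs to its domain only if its body is monotone in the bound variable.\<close>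

lemma interp_0:
  assumes "has_type ctype M A" and I: "\<And>c. I c \<in> D 0 (ctype c)"
    and "total_valuation 0 \<nu>" "total_valuation 0 \<nu>'" "\<And>v. le 0 (snd v) (\<nu> v) (\<nu>' v)"
  shows "interp Q \<rho> 0 I \<nu> M \<in> D 0 A \<and> le 0 A (interp Q \<rho> 0 I \<nu> M) (interp Q \<rho> 0 I \<nu>' M)"
  using assms(1,3-)
proof (induction arbitrary: \<nu> \<nu>')
  case (1 x A)
  then show ?case unfolding total_valuation_def by (metis interp.simps(1) snd_conv)
next
  case (2 c)
  then show ?case using I dle_refl by simp
next
  case (3 A)
  then show ?case using Ycomb_in_Dom dle_refl by (metis interp.simps(3))
next
  case (4 M A B N)
  have refl: "le 0 (snd v) (\<nu>' v) (\<nu>' v)" for v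
    using 4(6) dle_refl unfolding total_valuation_def by blast
  have M: "interp Q \<rho> 0 I \<nu> M \<in> D 0 (A \<Rrightarrow> B)"
    "le 0 (A \<Rrightarrow> B) (interp Q \<rho> 0 I \<nu> M) (interp Q \<rho> 0 I \<nu>' M)"
    using 4(3)[OF 4(5-7)] by auto
  have N: "interp Q \<rho> 0 I \<nu> N \<in> D 0 A" "le 0 A (interp Q \<rho> 0 I \<nu> N) (interp Q \<rho> 0 I \<nu>' N)"
    using 4(4)[OF 4(5-7)] by auto
  have M': "interp Q \<rho> 0 I \<nu>' M \<in> D 0 (A \<Rrightarrow> B)" and N': "interp Q \<rho> 0 I \<nu>' N \<in> D 0 A"
    using 4(3)[OF 4(6,6) refl] 4(4)[OF 4(6,6) refl] by blast+
  show ?case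
    using dle_app[OF M(1) M' M(2) N(1) N' N(2)] Dom_ArrD(2)[OF M(1) N(1)] by simp
next
  case (5 M B x A)
  have refl: "le 0 (snd v) (\<nu> v) (\<nu> v)" for v
    using 5(3) dle_refl unfolding total_valuation_def by blast
  have IH: "interp Q \<rho> 0 I (\<mu>((x, A) := p)) M \<in> D 0 B \<and>
      le 0 B (interp Q \<rho> 0 I (\<mu>((x, A) := p)) M) (interp Q \<rho> 0 I (\<mu>'((x, A) := p')) M)"
    if "p \<in> D 0 A" "p' \<in> D 0 A" "le 0 A p p'" "total_valuation 0 \<mu>" "total_valuation 0 \<mu>'"
      "\<And>v. le 0 (snd v) (\<mu> v) (\<mu>' v)" for p p' \<mu> \<mu>'
    using that by (intro 5(2) total_valuation_upd) auto
  have "mk_fun (D 0 A) (\<lambda>p. interp Q \<rho> 0 I (\<nu>((x, A) := p)) M) \<in> D 0 (A \<Rrightarrow> B)"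
    using IH[OF _ _ _ 5(3,3) refl] dle_refl by (intro mk_fun_in_Dom_0) blast+
  moreover have "le 0 B (interp Q \<rho> 0 I (\<nu>((x, A) := p)) M) (interp Q \<rho> 0 I (\<nu>'((x, A) := p)) M)"
    if "p \<in> D 0 A" for p
    using IH[OF that that _ 5(3-5)] dle_refl[OF that] by blast
  ultimately show ?case by (simp add: app_mk_fun_Dom del: Dom.simps)
qed

text \<open>This is the fundamental lemma for \<open>Lrel\<close>, joined with monotonicity at the
  upper level. The premise \<open>level_k\<close> places the lower meaning of an abstraction in its
  domain, as \<open>Lrel_mk_fun\<close> requires.\<close>

lemma interp_Suc:
  assumes "has_type ctype M A" and J: "\<And>c. (I c, J c) \<in> L k (ctype c)"
    and level_k: "\<And>M A \<nu>. has_type ctype M A \<Longrightarrow> total_valuation k \<nu> \<Longrightarrow> interp Q \<rho> k I \<nu> M \<in> D k A"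
    and "\<And>v. (\<nu>1 v, \<nu>2 v) \<in> L k (snd v)" "\<And>v. (\<nu>1' v, \<nu>2' v) \<in> L k (snd v)"
    and "\<And>v. le (Suc k) (snd v) (\<nu>2 v) (\<nu>2' v)"
  shows "(interp Q \<rho> k I \<nu>1 M, interp Q \<rho> (Suc k) J \<nu>2 M) \<in> L k A \<and>
    le (Suc k) A (interp Q \<rho> (Suc k) J \<nu>2 M) (interp Q \<rho> (Suc k) J \<nu>2' M)"
  using assms(1,4-)
proof (induction arbitrary: \<nu>1 \<nu>2 \<nu>1' \<nu>2')
  case (1 x A)
  then show ?case by (metis interp.simps(1) snd_conv)
next
  case (2 c)
  then show ?case using J LrelD dle_refl by (metis interp.simps(2))
next
  case (3 A)
  then show ?case using Ycomb_Lrel[OF Ycomb_in_Dom] Ycomb_in_Dom dle_refl by (metis interp.simps(3))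
next
  case (4 M A B N)
  have refl: "le (Suc k) (snd v) (\<nu>2' v) (\<nu>2' v)" for v
    using 4(6) dle_refl LrelD by blast
  have M: "(interp Q \<rho> k I \<nu>1 M, interp Q \<rho> (Suc k) J \<nu>2 M) \<in> L k (A \<Rrightarrow> B)"
    "le (Suc k) (A \<Rrightarrow> B) (interp Q \<rho> (Suc k) J \<nu>2 M) (interp Q \<rho> (Suc k) J \<nu>2' M)"
    using 4(3)[OF 4(5-7)] by auto
  have N: "(interp Q \<rho> k I \<nu>1 N, interp Q \<rho> (Suc k) J \<nu>2 N) \<in> L k A"
    "le (Suc k) A (interp Q \<rho> (Suc k) J \<nu>2 N) (interp Q \<rho> (Suc k) J \<nu>2' N)"
    using 4(4)[OF 4(5-7)] by auto
  \<comment> \<open>The induction hypotheses with the primed valuations on both sides supply the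
    domain conditions of \<open>dle_app\<close>.\<close>
  have "interp Q \<rho> (Suc k) J \<nu>2' M \<in> D (Suc k) (A \<Rrightarrow> B)" "interp Q \<rho> (Suc k) J \<nu>2' N \<in> D (Suc k) A"
    using 4(3)[OF 4(6,6) refl] 4(4)[OF 4(6,6) refl] LrelD by blast+
  then show ?case
    using Lrel_app[OF M(1) N(1)] dle_app[OF _ _ M(2) _ _ N(2)] LrelD[OF M(1)] LrelD[OF N(1)]
    by (simp del: Dom.simps)
next
  case (5 M B x A)
  have refl: "le (Suc k) (snd v) (\<nu>2 v) (\<nu>2 v)" for v
    using 5(3) dle_refl LrelD by blast
  have \<nu>1: "total_valuation k \<nu>1"
    using 5(3) LrelD unfolding total_valuation_def by blast
  have IH: "(interp Q \<rho> k I (\<mu>1((x, A) := p1)) M, interp Q \<rho> (Suc k) J (\<mu>2((x, A) := p2)) M) \<in> L k B \<and>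
      le (Suc k) B (interp Q \<rho> (Suc k) J (\<mu>2((x, A) := p2)) M)
        (interp Q \<rho> (Suc k) J (\<mu>2'((x, A) := p2')) M)"
    if "(p1, p2) \<in> L k A" "(p1', p2') \<in> L k A" "le (Suc k) A p2 p2'"
      "\<And>v. (\<mu>1 v, \<mu>2 v) \<in> L k (snd v)" "\<And>v. (\<mu>1' v, \<mu>2' v) \<in> L k (snd v)"
      "\<And>v. le (Suc k) (snd v) (\<mu>2 v) (\<mu>2' v)" for p1 p2 p1' p2' \<mu>1 \<mu>2 \<mu>1' \<mu>2'
    by (rule 5(2)[of _ _ "\<mu>1'((x, A) := p1')"]) (use that in auto)
  have "(mk_fun (D k A) (\<lambda>p. interp Q \<rho> k I (\<nu>1((x, A) := p)) M),
      mk_fun (D (Suc k) A) (\<lambda>p. interp Q \<rho> (Suc k) J (\<nu>2((x, A) := p)) M)) \<in> L k (A \<Rrightarrow> B)"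
  proof (rule Lrel_mk_fun)
    show "mk_fun (D k A) (\<lambda>p. interp Q \<rho> k I (\<nu>1((x, A) := p)) M) \<in> D k (A \<Rrightarrow> B)"
      using level_k[OF has_type.intros(5)[OF 5(1)] \<nu>1] by simp
    show "interp Q \<rho> (Suc k) J (\<nu>2((x, A) := p)) M \<in> D (Suc k) B" if "p \<in> D (Suc k) A" for p
      using IH[OF Lrel_down[OF that] Lrel_down[OF that] dle_refl[OF that] 5(3,3) refl] LrelD by blast
    show "le (Suc k) B (interp Q \<rho> (Suc k) J (\<nu>2((x, A) := p)) M)
        (interp Q \<rho> (Suc k) J (\<nu>2((x, A) := p')) M)"
      if "p \<in> D (Suc k) A" "p' \<in> D (Suc k) A" "le (Suc k) A p p'" for p p'
      using IH[OF Lrel_down[OF that(1)] Lrel_down[OF that(2)] that(3) 5(3,3) refl] by blast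
    show "(interp Q \<rho> k I (\<nu>1((x, A) := p1)) M, interp Q \<rho> (Suc k) J (\<nu>2((x, A) := p2)) M) \<in> L k B"
      if "(p1, p2) \<in> L k A" for p1 p2
      using IH[OF that that _ 5(3,3) refl] LrelD[OF that] dle_refl by blast
  qed
  moreover have "le (Suc k) B (interp Q \<rho> (Suc k) J (\<nu>2((x, A) := p)) M)
      (interp Q \<rho> (Suc k) J (\<nu>2'((x, A) := p)) M)" if "p \<in> D (Suc k) A" for p
    using IH[OF Lrel_down[OF that] Lrel_down[OF that] dle_refl[OF that] 5(3-5)] by blast
  ultimately show ?case by (simp add: app_mk_fun_Dom del: Dom.simps Lrel.simps)
qed

text \<open>Projecting the constants and the valuation one level down yields related data, and
  relatedness of the two meanings implies membership of the upper one. The induction generalises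
  over \<open>I\<close> because the constants change with the level.\<close>

lemma interp_in_Dom:
  assumes "\<And>c. I c \<in> D k (ctype c)" "has_type ctype M A" "total_valuation k \<nu>"
  shows "interp Q \<rho> k I \<nu> M \<in> D k A"
  using assms
proof (induction k arbitrary: I M A \<nu>)
  case 0
  then show ?case using interp_0[OF 0(2,1,3,3)] dle_refl unfolding total_valuation_def by blast
next
  case (Suc k)
  define I' where "I' c = down Q \<rho> k (ctype c) (I c)" for c
  define \<nu>' where "\<nu>' v = down Q \<rho> k (snd v) (\<nu> v)" for v
  have I': "(I' c, I c) \<in> L k (ctype c)" for c
    unfolding I'_def using Lrel_down Suc.prems(1) .
  have \<nu>': "(\<nu>' v, \<nu> v) \<in> L k (snd v)" for v
    unfolding \<nu>'_def using Lrel_down Suc.prems(3) unfolding total_valuation_def by blast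
  have "(interp Q \<rho> k I' \<nu>' M, interp Q \<rho> (Suc k) I \<nu> M) \<in> L k A"
    using interp_Suc[OF Suc.prems(2) I' Suc.IH \<nu>' \<nu>'] I' \<nu>' LrelD dle_refl by blast
  then show ?case using LrelD by blast
qed

section \<open>Substitution and soundness of conversion\<close>

lemma interp_cong:
  "(\<And>v. v \<in> FV M \<Longrightarrow> \<nu> v = \<nu>' v) \<Longrightarrow> interp Q \<rho> k I \<nu> M = interp Q \<rho> k I \<nu>' M"
proof (induction M arbitrary: \<nu> \<nu>')
  case (App M N)
  have "interp Q \<rho> k I \<nu> M = interp Q \<rho> k I \<nu>' M"
    by (rule App.IH(1)) (simp add: App.prems)
  moreover have "interp Q \<rho> k I \<nu> N = interp Q \<rho> k I \<nu>' N"
    by (rule App.IH(2)) (simp add: App.prems)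
  ultimately show ?case by simp
next
  case (Lam v M)
  have "interp Q \<rho> k I (\<nu>(v := p)) M = interp Q \<rho> k I (\<nu>'(v := p)) M" for p
    by (rule Lam.IH) (simp add: Lam.prems)
  then show ?case by simp
qed auto

text \<open>In the binder case the new name \<open>w\<close> avoids the free variables of all
  substituted terms that matter, so updating \<open>w\<close> leaves their values alone;
  \<open>w\<close> has the type of \<open>v\<close>, so the domain of the graph is
  unchanged.\<close>

lemma interp_psubst:
  "interp Q \<rho> k I \<nu> (psubst \<sigma> M) = interp Q \<rho> k I (\<lambda>v. interp Q \<rho> k I \<nu> (\<sigma> v)) M"
proof (induction M arbitrary: \<sigma> \<nu>)
  case (Lam v M)
  define F where "F = (\<Union>u \<in> FV M - {v}. FV (\<sigma> u))"
  define w where "w = pick_fresh v F"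
  have "finite F" unfolding F_def by (simp add: finite_FV)
  then have w: "w \<notin> F" "snd w = snd v"
    unfolding w_def by (simp_all add: pick_fresh_fresh snd_pick_fresh)
  have "interp Q \<rho> k I (\<lambda>u. interp Q \<rho> k I (\<nu>(w := p)) ((\<sigma>(v := Var w)) u)) M =
      interp Q \<rho> k I ((\<lambda>u. interp Q \<rho> k I \<nu> (\<sigma> u))(v := p)) M" for p
  proof (rule interp_cong)
    fix u assume u: "u \<in> FV M"
    show "interp Q \<rho> k I (\<nu>(w := p)) ((\<sigma>(v := Var w)) u) =
        ((\<lambda>u. interp Q \<rho> k I \<nu> (\<sigma> u))(v := p)) u"
    proof (cases "u = v")
      case False
      then have "w \<notin> FV (\<sigma> u)" using w(1) u unfolding F_def by blast
      then have "interp Q \<rho> k I (\<nu>(w := p)) (\<sigma> u) = interp Q \<rho> k I \<nu> (\<sigma> u)"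
        by (intro interp_cong) auto
      then show ?thesis using False by simp
    qed simp
  qed
  then show ?case
    by (simp only: psubst.simps interp.simps Let_def Lam.IH w(2) F_def[symmetric] w_def[symmetric])
qed auto

lemma interp_subst:
  "interp Q \<rho> k I \<nu> (M[v::=N]) = interp Q \<rho> k I (\<nu>(v := interp Q \<rho> k I \<nu> N)) M"
  unfolding subst_def interp_psubst by (rule interp_cong) simp

lemma interp_bd_eq:
  assumes "bd_eq ctype A M N" and I: "\<And>c. I c \<in> D k (ctype c)" and "total_valuation k \<nu>"
  shows "interp Q \<rho> k I \<nu> M = interp Q \<rho> k I \<nu> N"
  using assms(1,3)
proof (induction arbitrary: \<nu>)
  case (lam B M M' A x)
  then show ?case by (auto intro!: mk_fun_cong total_valuation_upd)
next
  case (alpha M B y A x)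
  \<comment> \<open>The right-hand side is what the substitution lemma makes of the renamed body;
    \<open>(y, A)\<close> is not free in \<open>M\<close>.\<close>
  have "interp Q \<rho> k I (\<nu>((x, A) := p)) M = interp Q \<rho> k I (\<nu>((y, A) := p, (x, A) := p)) M" for p
    using alpha.hyps(2) by (intro interp_cong) auto
  then show ?case by (simp add: interp_subst)
next
  case (beta M B N A x)
  \<comment> \<open>A graph can be evaluated only inside its domain, so the typing of
    \<open>N\<close> is used here.\<close>
  then show ?case using interp_in_Dom[OF I beta.hyps(2)] by (simp add: app_mk_fun_Dom interp_subst)
next
  case (delta M A)
  have M: "interp Q \<rho> k I \<nu> M \<in> D k (A \<Rrightarrow> A)" using interp_in_Dom[OF I delta.hyps delta.prems] .
  show ?case using fixpt(1)[OF M] M by (simp add: app_mk_fun_Dom del: Dom.simps)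
qed auto

lemma valuation_on_extend:
  assumes "valuation_on Q \<rho> k V \<nu>"
  obtains \<nu>' where "total_valuation k \<nu>'" "\<And>v. v \<in> V \<Longrightarrow> \<nu>' v = \<nu> v"
proof -
  obtain d where d: "\<And>A. d A \<in> D k A" using Dom_nonempty by metis
  have "total_valuation k (\<lambda>v. if v \<in> V then \<nu> v else d (snd v))"
    using assms d unfolding valuation_on_def total_valuation_def by auto
  then show thesis using that by simp
qed

end

theorem theorem4p12:
  fixes Q :: "'q set" and \<rho> :: "'q \<Rightarrow> nat" and m k :: nat
    and ctype :: "'c \<Rightarrow> ty" and I :: "'c \<Rightarrow> 'q val"
  assumes "finite Q"
    and "m = Max (\<rho> ` Q)"
    and "k \<le> m"
    and "\<forall>c. I c \<in> Dom Q \<rho> k (ctype c)"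
  shows "(\<forall>M A \<nu>. has_type ctype M A \<longrightarrow> valuation_on Q \<rho> k (FV M) \<nu> \<longrightarrow>
            interp Q \<rho> k I \<nu> M \<in> Dom Q \<rho> k A) \<and>
         (\<forall>A M N \<nu>. bd_eq ctype A M N \<longrightarrow> valuation_on Q \<rho> k (FV M \<union> FV N) \<nu> \<longrightarrow>
            interp Q \<rho> k I \<nu> M = interp Q \<rho> k I \<nu> N)"
proof (intro conjI allI impI)
  fix M :: "'c trm" and A \<nu>
  assume M: "has_type ctype M A" and \<nu>: "valuation_on Q \<rho> k (FV M) \<nu>"
  obtain \<nu>' where \<nu>': "total_valuation Q \<rho> k \<nu>'" "\<And>v. v \<in> FV M \<Longrightarrow> \<nu>' v = \<nu> v"
    using valuation_on_extend[OF assms(1) \<nu>] by blast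
  show "interp Q \<rho> k I \<nu> M \<in> Dom Q \<rho> k A"
    using interp_in_Dom[OF assms(1) assms(4)[rule_format] M \<nu>'(1)]
      interp_cong[OF assms(1) \<nu>'(2), where M = M] by simp
next
  fix A and M N :: "'c trm" and \<nu>
  assume MN: "bd_eq ctype A M N" and \<nu>: "valuation_on Q \<rho> k (FV M \<union> FV N) \<nu>"
  \<comment> \<open>A conversion from \<open>M\<close> to \<open>N\<close> may pass through terms
    with further free variables, so the valuation is first extended to all variables.\<close>
  obtain \<nu>' where \<nu>': "total_valuation Q \<rho> k \<nu>'" "\<And>v. v \<in> FV M \<union> FV N \<Longrightarrow> \<nu>' v = \<nu> v"
    using valuation_on_extend[OF assms(1) \<nu>] by blast
  have "interp Q \<rho> k I \<nu>' M = interp Q \<rho> k I \<nu>' N"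
    using interp_bd_eq[OF assms(1) MN _ \<nu>'(1)] assms(4) by blast
  moreover have "interp Q \<rho> k I \<nu>' P = interp Q \<rho> k I \<nu> P" if "P = M \<or> P = N" for P
    using that by (intro interp_cong[OF assms(1)] \<nu>'(2)) auto
  ultimately show "interp Q \<rho> k I \<nu> M = interp Q \<rho> k I \<nu> N" by metis
qed

end
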